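(* Let $G$ be a finite simple graph with maximum degree $k \geq 2$, let $M(G)$ be the set of vertices of $G$ of degree $k$, let $t = |M(G)|$, and let $n = |N_G[M(G)]|$, where $N_G[M(G)] = \bigcup_{v \in M(G)} (\{v\} \cup N_G(v))$ is the closed neighbourhood of $M(G)$. Suppose $n < (k+1)t$. Define \[b_1(k,t,n) = \frac{n + (k-1)t}{2k} \quad \text{and} \quad b_2(k,t,n) = n\left(1 - \frac{k}{k+1}\left(\frac{n}{(k+1)t}\right)^{1/k}\right).\] (a) Let $x_1 > 1$ be the real number $3.512\ldots$ such that $e^{(x_1-1)/2} = x_1$. There exists a unique real number $x_0$ such that $2.438\ldots \leq x_0 < x_1$ and $\left(\frac{2k}{2k+1-x_0}\right)^k = x_0$. We have $b_1(k,t,n) < b_2(k,t,n)$ if $n \geq \frac{1}{x_0}(k+1)t$. The larger $k$ is, the larger $x_0$ is. Moreover, for any real $\delta > 0$, $x_0 > x_1 - \delta$ if $k$ is sufficiently large. (b) Let $x_{1/4} > 1$ be the real number $7.908\ldots$ such that $\frac14 e^{(x_{1/4}-1)/2} = x_{1/4}$. There exists a unique real number $x_0'$ such that $5.594\ldots \leq x_0' < x_{1/4}$ and $\left(\frac{k+4}{2k+4}\right)^2 e^{(x_0'-1)/2} = x_0'$. We have $b_2(k,t,n) < b_1(k,t,n)$ if $n \leq \frac{1}{x_0'}(k+1)t$. The smaller $k$ is, the smaller $x_0'$ is.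
   Context: Graphs are finite and simple; $N_G(v)$ is the set of neighbours of $v$. The quantities $b_1(k,t,n)$ and $b_2(k,t,n)$ are known upper bounds on the minimum number of vertices whose removal from $G$ decreases the maximum degree; the theorem only compares the two expressions. *)

theory Defs
  imports Complex_Main
begin

definition simple_graph :: "'a set \<Rightarrow> 'a set set \<Rightarrow> bool" where
  "simple_graph V E \<longleftrightarrow> finite V \<and> (\<forall>e\<in>E. e \<subseteq> V \<and> card e = 2)"

definition nbrs :: "'a set \<Rightarrow> 'a set set \<Rightarrow> 'a \<Rightarrow> 'a set" where
  "nbrs V E v = {w \<in> V. {v, w} \<in> E}"

definition degree :: "'a set \<Rightarrow> 'a set set \<Rightarrow> 'a \<Rightarrow> nat" where
  "degree V E v = card (nbrs V E v)"

(* Inserting 0 only matters for the graph without vertices, whose maximum degree is set to 0. *)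
definition max_degree :: "'a set \<Rightarrow> 'a set set \<Rightarrow> nat" where
  "max_degree V E = Max (insert 0 (degree V E ` V))"

definition max_vertices :: "'a set \<Rightarrow> 'a set set \<Rightarrow> 'a set" where
  "max_vertices V E = {v \<in> V. degree V E v = max_degree V E}"

definition closed_nbhd :: "'a set \<Rightarrow> 'a set set \<Rightarrow> 'a set \<Rightarrow> 'a set" where
  "closed_nbhd V E S = (\<Union>v\<in>S. {v} \<union> nbrs V E v)"

definition b1 :: "nat \<Rightarrow> nat \<Rightarrow> nat \<Rightarrow> real" where
  "b1 k t n = (real n + (real k - 1) * real t) / (2 * real k)"

definition b2 :: "nat \<Rightarrow> nat \<Rightarrow> nat \<Rightarrow> real" where
  "b2 k t n = real n *
     (1 - real k / (real k + 1) * (real n / ((real k + 1) * real t)) powr (1 / real k))"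

definition x1 :: real where
  "x1 = (THE x. x > 1 \<and> exp ((x - 1) / 2) = x)"

definition x_quarter :: real where
  "x_quarter = (THE x. x > 1 \<and> 1 / 4 * exp ((x - 1) / 2) = x)"

(* The constants 2.438... and 5.594... are the values of x0 and x0' at k = 2.
   For k = 2 the equation for x0 reads (4 / (5 - x))^2 = x, that is
   (x - 1) * (x^2 - 9 * x + 16) = 0, whose only root in (1, 5) is (9 - sqrt 17) / 2;
   the equation for x0' has coefficient (6 / 8)^2 = 9 / 16. *)
definition x0_low :: real where
  "x0_low = (9 - sqrt 17) / 2"

definition x0'_low :: real where
  "x0'_low = (THE x. x > 1 \<and> 9 / 16 * exp ((x - 1) / 2) = x)"

definition x0 :: "nat \<Rightarrow> real" where
  "x0 k = (THE x. x0_low \<le> x \<and> x < x1 \<and> (2 * real k / (2 * real k + 1 - x)) ^ k = x)"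

definition x0' :: "nat \<Rightarrow> real" where
  "x0' k = (THE x. x0'_low \<le> x \<and> x < x_quarter \<and>
     ((real k + 4) / (2 * real k + 4))\<^sup>2 * exp ((x - 1) / 2) = x)"

end

theory Submission
  imports Defs
begin

text \<open>
  Put \<open>x = (k + 1) t / n > 1\<close> and \<open>y = (x - 1) / 2\<close>. The inequality \<open>b1 < b2\<close>
  is equivalent to \<open>x powr (- 1 / k) < 1 - (k - 1) y / k^2\<close>.

  (a) The right-hand side exceeds \<open>1 - y / k\<close>, so \<open>(1 - y / k) ^ (- k) \<le> x\<close> suffices.
  The left-hand side is strictly convex in \<open>x\<close> with fixed points \<open>1\<close> and \<open>x0\<close>, so the
  inequality holds exactly for \<open>x \<le> x0\<close>. It decreases strictly to \<open>exp y\<close> as \<open>k\<close>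
  grows, which gives the bounds, the monotonicity and the limit of \<open>x0\<close>.

  (b) With \<open>c = (k + 4) / (2 k + 4) \<le> 3 / 4\<close>, convexity of the exponential gives
  \<open>x \<le> c^2 exp y\<close> for \<open>x \<ge> x0'\<close>. As \<open>t \<le> n\<close>, we have \<open>y \<le> k / 2\<close>, and hence
  \<open>c^2 < exp (- 1 / 2) \<le> exp (- y / k)\<close>. Thus \<open>x < exp (y - y / k)\<close>, and
  \<open>x powr (- 1 / k) > exp (- (k - 1) y / k^2) \<ge> 1 - (k - 1) y / k^2\<close>.
\<close>

section \<open>Strictly convex maps and their fixed points\<close>

text \<open>Strict convexity is expressed by supporting lines of slope \<open>d\<close>.\<close>

locale strictly_convex_map =
  fixes h d :: "real \<Rightarrow> real" and S :: "real set"
  assumes tangent: "\<lbrakk>x \<in> S; y \<in> S; x \<noteq> y\<rbrakk> \<Longrightarrow> h x + d x * (y - x) < h y"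
    and one_in: "1 \<in> S" and at_one: "h 1 \<le> 1"
begin

text \<open>Evaluate the supporting line at \<open>x\<close> in \<open>1\<close> and in
  \<open>a\<close>, with weights \<open>a - x\<close> and \<open>x - 1\<close>: the slope terms
  cancel.\<close>

lemma below_fixed_point:
  assumes "a \<in> S" "h a = a" "x \<in> S" "1 < x" "x < a"
  shows "h x < x"
proof -
  have "(a - x) * (h x + d x * (1 - x)) < (a - x) * h 1"
    using tangent[of x 1] assms one_in by (intro mult_strict_left_mono) auto
  moreover have "(a - x) * h 1 \<le> (a - x) * 1"
    using at_one assms by (intro mult_left_mono) auto
  moreover have "(x - 1) * (h x + d x * (a - x)) < (x - 1) * a"
    using tangent[of x a] assms by (intro mult_strict_left_mono) auto
  ultimately have "(a - 1) * h x < (a - 1) * x"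
    by (simp add: algebra_simps)
  with assms show ?thesis by simp
qed

text \<open>Since \<open>h 1 \<le> 1\<close>, the supporting line at \<open>a\<close>, evaluated at
  \<open>1\<close>, forces \<open>d a > 1\<close>; to the right of \<open>a\<close> that line runs
  above the diagonal.\<close>

lemma above_fixed_point:
  assumes "a \<in> S" "h a = a" "1 < a" "x \<in> S" "a < x"
  shows "x < h x"
proof -
  have "1 * (a - 1) < d a * (a - 1)"
    using tangent[of a 1] assms one_in at_one by (simp add: algebra_simps)
  then have "1 < d a" using assms by (simp only: mult_less_cancel_right)
  then have "1 * (x - a) < d a * (x - a)"
    using assms(5) by (intro mult_strict_right_mono) auto
  moreover have "a + d a * (x - a) < h x" using tangent[of a x] assms by simp
  ultimately show ?thesis by (simp only: mult_1)
qed

lemma fixed_point_unique: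
  assumes "a \<in> S" "h a = a" "1 < a" "b \<in> S" "h b = b" "1 < b"
  shows "a = b"
  using below_fixed_point[of a b] above_fixed_point[of a b] assms
  by (cases a b rule: linorder_cases) auto

text \<open>The tool for comparing fixed points: a fixed point of a larger map is moved strictly
  down by a smaller map.\<close>

lemma less_fixed_point:
  assumes "a \<in> S" "h a = a" "1 < a" "x \<in> S" "h x < x"
  shows "x < a"
  using above_fixed_point[of a x] assms by (cases a x rule: linorder_cases) auto

lemma fixed_point_exists:
  assumes "continuous_on {l..r} h" "l \<le> r" "h l \<le> l" "r < h r"
  obtains a where "l \<le> a" "a < r" "h a = a"
proof -
  have "continuous_on {l..r} (\<lambda>x. h x - x)"
    by (intro continuous_intros assms)
  then obtain a where a: "l \<le> a" "a \<le> r" "h a - a = 0"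
    using IVT'[of "\<lambda>x. h x - x" l 0 r] assms by auto
  with assms(4) have "a \<noteq> r" by auto
  with a show thesis by (intro that[of a]) auto
qed

lemma fixed_point_ex1:
  assumes "continuous_on {l..r} h" "{l..r} \<subseteq> S" "1 < l" "l \<le> r" "h l \<le> l" "r < h r"
  shows "\<exists>!x. l \<le> x \<and> x < r \<and> h x = x"
proof -
  obtain a where a: "l \<le> a" "a < r" "h a = a"
    using fixed_point_exists assms by blast
  show ?thesis
  proof (rule ex1I[of _ a])
    show "x = a" if "l \<le> x \<and> x < r \<and> h x = x" for x
      using fixed_point_unique[of x a] that a assms by (auto simp: subset_iff)
  qed (use a in simp)
qed

end

section \<open>The exponential map\<close>

lemma exp_gt_add_one:
  assumes "(u::real) \<noteq> 0"
  shows "1 + u < exp u"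
proof -
  obtain t where "exp u = (\<Sum>m<2. u ^ m / fact m) + exp t / fact 2 * u ^ 2"
    using Maclaurin_exp_le[of u 2] by auto
  then have "exp u = 1 + u + exp t / 2 * u\<^sup>2"
    by (simp add: numeral_2_eq_2)
  then show ?thesis using assms by simp
qed

text \<open>For even order the Lagrange remainder is nonnegative whatever the sign of
  \<open>u\<close>.\<close>

lemma exp_ge_even_Taylor:
  assumes "even n"
  shows "(\<Sum>m<n. (u::real) ^ m / fact m) \<le> exp u"
proof -
  obtain t where "exp u = (\<Sum>m<n. u ^ m / fact m) + exp t / fact n * u ^ n"
    using Maclaurin_exp_le[of u n] by auto
  then show ?thesis using assms by (simp add: zero_le_even_power)
qed

text \<open>One family for four equations: \<open>c\<close> is \<open>1\<close> for
  \<open>x1\<close>, \<open>1 / 4\<close> for \<open>x_quarter\<close>, \<open>9 / 16\<close> for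
  \<open>x0'_low\<close> and \<open>coeff k\<close> for \<open>x0' k\<close>.\<close>

definition expmap :: "real \<Rightarrow> real \<Rightarrow> real" where
  "expmap c x = c * exp ((x - 1) / 2)"

text \<open>The slope is the derivative, and \<open>c \<le> 1\<close> says
  \<open>expmap c 1 \<le> 1\<close>.\<close>

lemma expmap_strictly_convex:
  assumes "0 < c" "c \<le> 1"
  shows "strictly_convex_map (expmap c) (\<lambda>x. expmap c x / 2) UNIV"
proof
  fix x y :: real assume "x \<noteq> y"
  then have "expmap c x * (1 + (y - x) / 2) < expmap c x * exp ((y - x) / 2)"
    using assms by (intro mult_strict_left_mono exp_gt_add_one) (auto simp: expmap_def)
  also have "\<dots> = c * (exp ((x - 1) / 2) * exp ((y - x) / 2))"
    by (simp add: expmap_def)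
  also have "\<dots> = expmap c y"
    unfolding expmap_def exp_add[symmetric] by (simp add: field_simps)
  finally show "expmap c x + expmap c x / 2 * (y - x) < expmap c y"
    by (simp add: algebra_simps)
qed (use assms in \<open>auto simp: expmap_def\<close>)

lemma continuous_on_expmap: "continuous_on A (expmap c)"
  unfolding expmap_def by (intro continuous_intros) auto

section \<open>Numerical enclosures of the constants\<close>

lemma expmap_The_fixed_point:
  assumes c: "0 < c" "c \<le> 1" and "1 < l" "l \<le> r" "expmap c l \<le> l" "r < expmap c r"
  defines "a \<equiv> THE x. x > 1 \<and> c * exp ((x - 1) / 2) = x"
  shows "\<exists>!x. x > 1 \<and> c * exp ((x - 1) / 2) = x"
    and "l \<le> a" "a < r" "expmap c a = a"
proof -
  interpret strictly_convex_map "expmap c" "\<lambda>x. expmap c x / 2" UNIV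
    using c by (rule expmap_strictly_convex)
  obtain b where b: "l \<le> b" "b < r" "expmap c b = b"
    using fixed_point_exists[OF continuous_on_expmap] assms by blast
  have b': "b > 1 \<and> c * exp ((b - 1) / 2) = b"
    using b assms(3) by (simp add: expmap_def)
  have uniq: "x = b" if "x > 1 \<and> c * exp ((x - 1) / 2) = x" for x
    using fixed_point_unique[of x b] that b' by (simp add: expmap_def)
  show "\<exists>!x. x > 1 \<and> c * exp ((x - 1) / 2) = x"
    using b' uniq by blast
  have "a = b"
    unfolding a_def using b' uniq by (rule the_equality)
  with b show "l \<le> a" "a < r" "expmap c a = a" by auto
qed

text \<open>Trades an upper bound on an exponential for a lower bound on its reciprocal, which an
  even Taylor polynomial can certify.\<close>

lemma expmap_le_if_exp_minus_ge:
  assumes "0 < l" "c / l \<le> exp (- ((l - 1) / 2))"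
  shows "expmap c l \<le> l"
proof -
  have "c / l * exp ((l - 1) / 2) \<le> exp (- ((l - 1) / 2)) * exp ((l - 1) / 2)"
    using assms by (intro mult_right_mono) auto
  also have "\<dots> = 1" by (simp add: exp_minus)
  finally show ?thesis using assms by (simp add: expmap_def field_simps)
qed

lemma x1_existence: "\<exists>!x::real. x > 1 \<and> exp ((x - 1) / 2) = x"
  and x1_bounds: "3.512 \<le> x1" "x1 < 3.513"
  and expmap_x1: "expmap 1 x1 = x1"
proof -
  have "(1::real) / 3.512 \<le> (\<Sum>m<12. (- ((3.512 - 1) / 2)) ^ m / fact m)"
    by (simp add: lessThan_nat_numeral fact_numeral power_divide)
  also have "\<dots> \<le> exp (- ((3.512 - 1) / 2))" by (rule exp_ge_even_Taylor) simp
  finally have lo: "expmap 1 3.512 \<le> 3.512"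
    by (intro expmap_le_if_exp_minus_ge) auto
  have "(3.513::real) < (\<Sum>m<12. ((3.513 - 1) / 2) ^ m / fact m)"
    by (simp add: lessThan_nat_numeral fact_numeral power_divide)
  also have "\<dots> \<le> exp ((3.513 - 1) / 2)" by (rule exp_ge_even_Taylor) simp
  finally have hi: "3.513 < expmap 1 3.513" by (simp add: expmap_def)
  note * = expmap_The_fixed_point[of 1 "3.512" "3.513", OF _ _ _ _ lo hi]
  show "\<exists>!x::real. x > 1 \<and> exp ((x - 1) / 2) = x" using *(1) by simp
  show "3.512 \<le> x1" "x1 < 3.513" "expmap 1 x1 = x1"
    using *(2-4) by (simp_all add: x1_def)
qed

lemma x_quarter_existence: "\<exists>!x::real. x > 1 \<and> 1 / 4 * exp ((x - 1) / 2) = x"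
  and x_quarter_bounds: "7.908 \<le> x_quarter" "x_quarter < 7.909"
  and expmap_x_quarter: "expmap (1 / 4) x_quarter = x_quarter"
proof -
  \<comment> \<open>The arguments here are near 3.45, against 1.26 for \<open>x1\<close>; hence 20
    Taylor terms instead of 12.\<close>
  have "(1 / 4::real) / 7.908 \<le> (\<Sum>m<20. (- ((7.908 - 1) / 2)) ^ m / fact m)"
    by (simp add: lessThan_nat_numeral fact_numeral power_divide)
  also have "\<dots> \<le> exp (- ((7.908 - 1) / 2))" by (rule exp_ge_even_Taylor) simp
  finally have lo: "expmap (1 / 4) 7.908 \<le> 7.908"
    by (intro expmap_le_if_exp_minus_ge) auto
  have "(4 * 7.909::real) < (\<Sum>m<20. ((7.909 - 1) / 2) ^ m / fact m)"
    by (simp add: lessThan_nat_numeral fact_numeral power_divide)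
  also have "\<dots> \<le> exp ((7.909 - 1) / 2)" by (rule exp_ge_even_Taylor) simp
  finally have hi: "7.909 < expmap (1 / 4) 7.909" by (simp add: expmap_def)
  note * = expmap_The_fixed_point[of "1 / 4" "7.908" "7.909", OF _ _ _ _ lo hi]
  show "\<exists>!x::real. x > 1 \<and> 1 / 4 * exp ((x - 1) / 2) = x" using *(1) by simp
  show "7.908 \<le> x_quarter" "x_quarter < 7.909" "expmap (1 / 4) x_quarter = x_quarter"
    using *(2-4) by (simp_all add: x_quarter_def)
qed

lemma x0'_low_existence: "\<exists>!x::real. x > 1 \<and> 9 / 16 * exp ((x - 1) / 2) = x"
  and x0'_low_bounds: "5.594 \<le> x0'_low" "x0'_low < 5.595"
  and expmap_x0'_low: "expmap (9 / 16) x0'_low = x0'_low"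
proof -
  have "(9 / 16::real) / 5.594 \<le> (\<Sum>m<20. (- ((5.594 - 1) / 2)) ^ m / fact m)"
    by (simp add: lessThan_nat_numeral fact_numeral power_divide)
  also have "\<dots> \<le> exp (- ((5.594 - 1) / 2))" by (rule exp_ge_even_Taylor) simp
  finally have lo: "expmap (9 / 16) 5.594 \<le> 5.594"
    by (intro expmap_le_if_exp_minus_ge) auto
  have "(16 / 9 * 5.595::real) < (\<Sum>m<20. ((5.595 - 1) / 2) ^ m / fact m)"
    by (simp add: lessThan_nat_numeral fact_numeral power_divide)
  also have "\<dots> \<le> exp ((5.595 - 1) / 2)" by (rule exp_ge_even_Taylor) simp
  finally have hi: "5.595 < expmap (9 / 16) 5.595" by (simp add: expmap_def)
  note * = expmap_The_fixed_point[of "9 / 16" "5.594" "5.595", OF _ _ _ _ lo hi]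
  show "\<exists>!x::real. x > 1 \<and> 9 / 16 * exp ((x - 1) / 2) = x" using *(1) by simp
  show "5.594 \<le> x0'_low" "x0'_low < 5.595" "expmap (9 / 16) x0'_low = x0'_low"
    using *(2-4) by (simp_all add: x0'_low_def)
qed

lemma x0_low_bounds: "2.438 \<le> x0_low" "x0_low < 2.439"
proof -
  \<comment> \<open>4.124 = 9 - 2 * 2.438, and 4.122 below is 9 - 2 * 2.439.\<close>
  have "sqrt 17 \<le> 4.124" by (rule real_le_lsqrt) (auto simp: power2_eq_square)
  moreover have "4.122 < sqrt 17" by (rule real_less_rsqrt) (auto simp: power2_eq_square)
  ultimately show "2.438 \<le> x0_low" "x0_low < 2.439" by (auto simp: x0_low_def)
qed

section \<open>The power map\<close>

definition powmap :: "nat \<Rightarrow> real \<Rightarrow> real" where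
  "powmap k x = (2 * real k / (2 * real k + 1 - x)) ^ k"

text \<open>With \<open>p\<close> and \<open>q\<close> the denominators at \<open>x\<close> and
  \<open>y\<close>, the ratio of the values is \<open>(p / q) ^ k\<close>. Bernoulli bounds it below
  by \<open>1 + k * (p - q) / q\<close>, which exceeds the tangent term
  \<open>1 + k * (p - q) / p\<close>.\<close>

lemma powmap_strictly_convex:
  assumes "k > 0"
  shows "strictly_convex_map (powmap k) (\<lambda>x. powmap k x * (real k / (2 * real k + 1 - x)))
    {..<2 * real k + 1}"
proof
  fix x y :: real
  assume x: "x \<in> {..<2 * real k + 1}" and y: "y \<in> {..<2 * real k + 1}" and "x \<noteq> y"
  define p q where "p = 2 * real k + 1 - x" and "q = 2 * real k + 1 - y"
  have pq: "p > 0" "q > 0" "p \<noteq> q" "y - x = p - q"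
    using x y \<open>x \<noteq> y\<close> by (auto simp: p_def q_def)
  have px: "powmap k x > 0" using pq assms by (simp add: powmap_def p_def)
  have "(p - q) / q - (p - q) / p = (p - q)\<^sup>2 / (p * q)"
    using pq by (simp add: field_simps power2_eq_square)
  also have "\<dots> > 0" using pq by simp
  finally have "real k * ((p - q) / p) < real k * ((p - q) / q)"
    using assms by (intro mult_strict_left_mono) auto
  then have "1 + real k / p * (p - q) < 1 + real k * ((p - q) / q)" by simp
  also have "\<dots> \<le> (1 + (p - q) / q) ^ k"
    using pq by (intro Bernoulli_inequality) (simp add: field_simps)
  also have "1 + (p - q) / q = p / q" using pq by (simp add: field_simps)
  finally have "powmap k x * (1 + real k / p * (p - q)) < powmap k x * (p / q) ^ k"
    using px by (intro mult_strict_left_mono)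
  also have "powmap k x * (p / q) ^ k = powmap k y"
    using pq unfolding powmap_def p_def[symmetric] q_def[symmetric]
    by (simp flip: power_mult_distrib)
  finally show "powmap k x + powmap k x * (real k / (2 * real k + 1 - x)) * (y - x) < powmap k y"
    unfolding p_def[symmetric] pq(4) by (simp add: distrib_left)
qed (use assms in \<open>auto simp: powmap_def\<close>)

lemma powmap_eq:
  assumes "k > 0"
  shows "powmap k x = inverse ((1 + (- ((x - 1) / 2)) / real k) ^ k)"
proof -
  \<comment> \<open>At the pole \<open>x = 2 * k + 1\<close> both sides are 0, by the convention for
    division by zero.\<close>
  have "2 * real k / (2 * real k + 1 - x) = inverse (1 + (- ((x - 1) / 2)) / real k)"
    using assms by (simp add: field_simps)
  then show ?thesis by (simp add: powmap_def power_inverse)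
qed

section \<open>Monotonicity in k and the exponential limit\<close>

lemma Bernoulli_strict:
  assumes "(z::real) \<ge> -1" "z \<noteq> 0" "n \<ge> 1"
  shows "1 + real (Suc n) * z < (1 + z) ^ Suc n"
proof -
  have "(1 + z) * (1 + real n * z) \<le> (1 + z) * (1 + z) ^ n"
    using assms by (intro mult_left_mono Bernoulli_inequality) auto
  moreover have "(1 + z) * (1 + real n * z) = 1 + real (Suc n) * z + real n * z\<^sup>2"
    by (simp add: algebra_simps power2_eq_square)
  moreover have "real n * z\<^sup>2 > 0" using assms by simp
  ultimately show ?thesis by simp
qed

lemma one_minus_power_strict_mono:
  assumes "0 < y" "y < real n" "n \<ge> 1"
  shows "(1 - y / real n) ^ n < (1 - y / real (Suc n)) ^ Suc n"
proof -
  define q where "q = 1 - y / real n"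
  \<comment> \<open>This \<open>z\<close> solves \<open>q * (1 + z) = 1 - y / (n + 1)\<close>, and
    it also makes \<open>q * (1 + (n + 1) * z)\<close> equal to 1, so strict Bernoulli applies after
    multiplying by \<open>q ^ (n + 1)\<close>.\<close>
  define z where "z = y / (real (Suc n) * (real n - y))"
  have q: "q > 0" using assms by (simp add: q_def)
  have z: "z > 0" using assms by (simp add: z_def)
  have qz: "q * (1 + z) = 1 - y / real (Suc n)"
    using assms by (simp add: q_def z_def divide_simps) (simp add: algebra_simps)
  have q1: "q * (1 + real (Suc n) * z) = 1"
    using assms by (simp add: q_def z_def divide_simps)
  have "q ^ n = q ^ Suc n * (1 + real (Suc n) * z)"
    using q1 by (metis mult.assoc mult.right_neutral power_Suc2)
  also have "\<dots> < q ^ Suc n * (1 + z) ^ Suc n"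
    using q z assms by (intro mult_strict_left_mono Bernoulli_strict) auto
  also have "\<dots> = (1 - y / real (Suc n)) ^ Suc n"
    unfolding qz[symmetric] by (simp add: power_mult_distrib)
  finally show ?thesis by (simp add: q_def)
qed

text \<open>The bound 5 is the pole \<open>2 * k + 1\<close> at \<open>k = 2\<close>, so
  \<open>x\<close> lies left of all poles.\<close>

lemma powmap_strict_antimono:
  assumes "2 \<le> i" "i < j" "1 < x" "x < 5"
  shows "powmap j x < powmap i x"
proof -
  \<comment> \<open>The shift by 2 starts the sequence at \<open>k = 2\<close>; the sign turns the
    decrease into the increase that \<open>lift_Suc_mono_less\<close> expects.\<close>
  define f where "f n = - powmap (n + 2) x" for n
  have step: "f n < f (Suc n)" for n
  proof -
    define y where "y = (x - 1) / 2"
    have y: "0 < y" "y < real (n + 2)" using assms by (auto simp: y_def)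
    have "powmap (Suc (n + 2)) x < powmap (n + 2) x"
      using one_minus_power_strict_mono[of y "n + 2"] y
      by (simp only: powmap_eq zero_less_Suc add_2_eq_Suc' flip: y_def)
         (auto intro!: less_imp_inverse_less zero_less_power simp: field_simps simp del: power_Suc)
    then show ?thesis by (simp add: f_def)
  qed
  have "f (i - 2) < f (j - 2)"
    using assms by (intro lift_Suc_mono_less[of f, OF step]) auto
  moreover have "i - 2 + 2 = i" "j - 2 + 2 = j" using assms by auto
  ultimately show ?thesis by (simp only: f_def neg_less_iff_less)
qed

text \<open>Raise \<open>1 - y / k < exp (- y / k)\<close> to the power \<open>k\<close> and
  invert.\<close>

lemma powmap_gt_expmap:
  assumes "k > 0" "1 < x" "x < 2 * real k + 1"
  shows "expmap 1 x < powmap k x"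
proof -
  define y where "y = (x - 1) / 2"
  have y: "0 < y" "y < real k" using assms by (auto simp: y_def)
  have "(1 + (- y) / real k) ^ k < exp ((- y) / real k) ^ k"
    using y assms by (intro power_strict_mono exp_gt_add_one) auto
  also have "\<dots> = exp (- y)"
    using assms by (simp flip: exp_of_nat_mult)
  finally have "inverse (exp (- y)) < inverse ((1 + (- y) / real k) ^ k)"
    using y by (intro less_imp_inverse_less zero_less_power) auto
  then show ?thesis
    using assms by (simp add: powmap_eq expmap_def exp_minus flip: y_def)
qed

lemma powmap_tendsto_expmap: "(\<lambda>k. powmap k x) \<longlonglongrightarrow> expmap 1 x"
proof -
  define y where "y = (x - 1) / 2"
  have "(\<lambda>k. inverse ((1 + (- y) / real k) ^ k)) \<longlonglongrightarrow> inverse (exp (- y))"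
    by (intro tendsto_inverse tendsto_exp_limit_sequentially) simp
  moreover have "\<forall>\<^sub>F k in sequentially. inverse ((1 + (- y) / real k) ^ k) = powmap k x"
    using eventually_gt_at_top[of 0] by eventually_elim (simp add: powmap_eq y_def)
  ultimately show ?thesis
    by (simp add: expmap_def exp_minus y_def Lim_transform_eventually)
qed

section \<open>The fixed points of the power maps\<close>

lemma powmap_2_x0_low: "powmap 2 x0_low = x0_low"
proof -
  define s where "s = sqrt 17"
  have s: "s * s = 17" "s \<ge> 0" by (auto simp: s_def)
  have "x0_low * (5 - x0_low)\<^sup>2 = 16"
    unfolding x0_low_def s_def[symmetric] using s(1) by (simp add: field_simps power2_eq_square)
  then show ?thesis
    using x0_low_bounds by (simp add: powmap_def power_divide field_simps)
qed

text \<open>At the left end \<open>powmap j\<close> is at most \<open>powmap 2\<close>, which fixes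
  \<open>x0_low\<close>; at the right end it exceeds \<open>expmap 1\<close>, which fixes
  \<open>x1\<close>.\<close>

lemma x0_existence:
  assumes "2 \<le> j"
  shows "\<exists>!x. x0_low \<le> x \<and> x < x1 \<and> powmap j x = x"
proof -
  interpret strictly_convex_map "powmap j" "\<lambda>x. powmap j x * (real j / (2 * real j + 1 - x))"
    "{..<2 * real j + 1}"
    using assms by (intro powmap_strictly_convex) auto
  show ?thesis
  proof (rule fixed_point_ex1)
    show "continuous_on {x0_low..x1} (powmap j)"
      unfolding powmap_def using x1_bounds assms by (intro continuous_intros) auto
    show "powmap j x0_low \<le> x0_low"
      using powmap_strict_antimono[of 2 j x0_low] powmap_2_x0_low x0_low_bounds assms
      by (cases "j = 2") auto
    show "x1 < powmap j x1"
      using powmap_gt_expmap[of j x1] expmap_x1 x1_bounds assms by simp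
  qed (use x1_bounds x0_low_bounds assms in auto)
qed

lemma x0_fixed_point:
  assumes "2 \<le> j"
  shows "x0_low \<le> x0 j" "x0 j < x1" "powmap j (x0 j) = x0 j"
  using theI'[OF x0_existence[OF assms]] by (auto simp: x0_def powmap_def)

lemma powmap_le_below_x0:
  assumes "2 \<le> j" "1 < x" "x \<le> x0 j"
  shows "powmap j x \<le> x"
proof -
  interpret strictly_convex_map "powmap j" "\<lambda>x. powmap j x * (real j / (2 * real j + 1 - x))"
    "{..<2 * real j + 1}"
    using assms by (intro powmap_strictly_convex) auto
  show ?thesis
    using below_fixed_point[of "x0 j" x] x0_fixed_point[OF assms(1)] assms x1_bounds
    by (cases "x = x0 j") auto
qed

lemma less_x0:
  assumes "2 \<le> j" "x < 5" "powmap j x < x"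
  shows "x < x0 j"
proof -
  interpret strictly_convex_map "powmap j" "\<lambda>x. powmap j x * (real j / (2 * real j + 1 - x))"
    "{..<2 * real j + 1}"
    using assms by (intro powmap_strictly_convex) auto
  show ?thesis
    using less_fixed_point[of "x0 j" x] x0_fixed_point[OF assms(1)] assms x1_bounds x0_low_bounds
    by auto
qed

text \<open>The smaller map \<open>powmap j\<close> moves the fixed point \<open>x0 i\<close> of
  \<open>powmap i\<close> strictly down.\<close>

lemma x0_strict_mono:
  assumes "2 \<le> i" "i < j"
  shows "x0 i < x0 j"
  using powmap_strict_antimono[of i j "x0 i"] x0_fixed_point[of i] less_x0[of j "x0 i"]
    x1_bounds x0_low_bounds assms by auto

lemma x0_eventually_gt:
  assumes "\<delta> > 0"
  shows "\<forall>\<^sub>F j in sequentially. x0 j > x1 - \<delta>"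
proof -
  interpret strictly_convex_map "expmap 1" "\<lambda>x. expmap 1 x / 2" UNIV
    by (rule expmap_strictly_convex) auto
  \<comment> \<open>The 2 keeps \<open>x\<close> above 1 when \<open>\<delta>\<close> is large.
    Convergence is needed only at this one point.\<close>
  define x where "x = max (x1 - \<delta>) 2"
  have x: "1 < x" "x < x1" "x1 - \<delta> \<le> x" using assms x1_bounds by (auto simp: x_def)
  then have "expmap 1 x < x" using below_fixed_point[of x1 x] expmap_x1 by auto
  then have "\<forall>\<^sub>F j in sequentially. powmap j x < x"
    by (rule order_tendstoD(2)[OF powmap_tendsto_expmap])
  then show ?thesis using eventually_ge_at_top[of 2]
  proof eventually_elim
    case (elim j)
    with less_x0[of j x] x x1_bounds show ?case by simp
  qed
qed

section \<open>The fixed points of the exponential maps\<close>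

text \<open>Decreases from \<open>9 / 16\<close> at \<open>k = 2\<close> towards
  \<open>1 / 4\<close>, the coefficients defining \<open>x0'_low\<close> and
  \<open>x_quarter\<close>.\<close>

definition coeff :: "nat \<Rightarrow> real" where
  "coeff k = ((real k + 4) / (2 * real k + 4))\<^sup>2"

lemma coeff_strict_antimono: "i < j \<Longrightarrow> coeff j < coeff i"
  unfolding coeff_def by (intro power_strict_mono) (auto simp: divide_simps algebra_simps)

lemma coeff_2: "coeff 2 = 9 / 16"
  by (simp add: coeff_def power2_eq_square)

lemma coeff_le: "2 \<le> j \<Longrightarrow> coeff j \<le> 9 / 16"
  using coeff_strict_antimono[of 2 j] coeff_2 by (cases "j = 2") auto

lemma coeff_gt: "1 / 4 < coeff j"
proof -
  have "(1 / 2)\<^sup>2 < coeff j"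
    unfolding coeff_def by (intro power_strict_mono) (auto simp: field_simps)
  then show ?thesis by (simp add: power2_eq_square)
qed

lemma expmap_coeff_strictly_convex:
  "2 \<le> j \<Longrightarrow> strictly_convex_map (expmap (coeff j)) (\<lambda>x. expmap (coeff j) x / 2) UNIV"
  using coeff_le[of j] coeff_gt[of j] by (intro expmap_strictly_convex) auto

lemma expmap_strict_mono_coeff: "c < c' \<Longrightarrow> expmap c x < expmap c' x"
  by (simp add: expmap_def)

lemma x0'_existence:
  assumes "2 \<le> j"
  shows "\<exists>!x. x0'_low \<le> x \<and> x < x_quarter \<and> expmap (coeff j) x = x"
proof -
  interpret strictly_convex_map "expmap (coeff j)" "\<lambda>x. expmap (coeff j) x / 2" UNIV
    using assms by (rule expmap_coeff_strictly_convex)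
  show ?thesis
  proof (rule fixed_point_ex1)
    show "expmap (coeff j) x0'_low \<le> x0'_low"
      using mult_right_mono[OF coeff_le[OF assms] exp_ge_zero, of "(x0'_low - 1) / 2"] expmap_x0'_low
      unfolding expmap_def by linarith
    show "x_quarter < expmap (coeff j) x_quarter"
      using expmap_strict_mono_coeff[OF coeff_gt, of x_quarter j] expmap_x_quarter by simp
  qed (use x_quarter_bounds x0'_low_bounds in \<open>auto intro: continuous_on_expmap\<close>)
qed

lemma x0'_fixed_point:
  assumes "2 \<le> j"
  shows "x0'_low \<le> x0' j" "expmap (coeff j) (x0' j) = x0' j"
  using theI'[OF x0'_existence[OF assms]] by (auto simp: x0'_def expmap_def coeff_def)

lemma expmap_ge_above_x0':
  assumes "2 \<le> j" "x0' j \<le> x"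
  shows "x \<le> expmap (coeff j) x"
proof -
  interpret strictly_convex_map "expmap (coeff j)" "\<lambda>x. expmap (coeff j) x / 2" UNIV
    using assms by (intro expmap_coeff_strictly_convex)
  show ?thesis
    using above_fixed_point[of "x0' j" x] x0'_fixed_point[OF assms(1)] assms x0'_low_bounds
    by (cases "x = x0' j") auto
qed

lemma x0'_strict_mono:
  assumes "2 \<le> i" "i < j"
  shows "x0' i < x0' j"
proof -
  interpret strictly_convex_map "expmap (coeff j)" "\<lambda>x. expmap (coeff j) x / 2" UNIV
    using assms by (intro expmap_coeff_strictly_convex) auto
  show ?thesis
    using less_fixed_point[of "x0' j" "x0' i"] x0'_fixed_point[of i] x0'_fixed_point[of j]
      expmap_strict_mono_coeff[OF coeff_strict_antimono[of i j], of "x0' i"] assms x0'_low_bounds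
    by auto
qed

section \<open>Comparison of the two bounds\<close>

text \<open>Since the factor in front is positive, the bracket, which depends only on
  \<open>k\<close> and \<open>x\<close>, decides the sign.\<close>

lemma b1_b2_diff:
  assumes "k \<ge> 2" "n > 0" "t > 0"
  defines "x \<equiv> (real k + 1) * real t / real n"
  shows "b2 k t n - b1 k t n = real n * real k / (real k + 1) *
    ((1 - (real k - 1) * ((x - 1) / 2) / (real k)\<^sup>2) - x powr (- (1 / real k)))"
proof -
  define w where "w = x powr (- (1 / real k))"
  have x: "x > 0" using assms by (simp add: x_def)
  have "real n / ((real k + 1) * real t) = inverse x" by (simp add: x_def)
  then have "(real n / ((real k + 1) * real t)) powr (1 / real k) = w"
    using x by (simp add: w_def powr_minus inverse_powr)
  then have b2: "b2 k t n = real n * (1 - real k / (real k + 1) * w)" by (simp add: b2_def)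
  have "real t = real n * x / (real k + 1)" using assms by (simp add: x_def)
  then have b1: "b1 k t n = (real n + (real k - 1) * (real n * x / (real k + 1))) / (2 * real k)"
    by (simp only: b1_def)
  have k: "real k > 0" using assms by simp
  then have k1: "real k + 1 \<noteq> 0" by simp
  show ?thesis
    unfolding b1 b2 w_def[symmetric] using k k1
    by (simp add: divide_simps power2_eq_square) (simp add: algebra_simps)
qed

lemma b1_less_b2:
  assumes "k \<ge> 2" "n > 0" "n < (k + 1) * t" "real n \<ge> 1 / x0 k * (real k + 1) * real t"
  shows "b1 k t n < b2 k t n"
proof -
  define x where "x = (real k + 1) * real t / real n"
  define y where "y = (x - 1) / 2"
  have t: "t > 0" using assms by (cases t) auto
  have "real n < (real k + 1) * real t"
    using assms(3) by (metis of_nat_1 of_nat_add of_nat_less_iff of_nat_mult)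
  then have x: "x > 1" using assms by (simp add: x_def)
  have "x0 k > 0" using x0_fixed_point[OF assms(1)] x0_low_bounds by simp
  then have xle: "x \<le> x0 k" using assms by (simp add: x_def field_simps)
  \<comment> \<open>Here \<open>x < x1 < 3.513\<close>, so \<open>y < 2 \<le> k\<close>.\<close>
  then have "y < real k" using x0_fixed_point[OF assms(1)] x1_bounds assms(1) by (simp add: y_def)
  then have q: "1 - y / real k > 0" using assms by simp
  have "inverse ((1 - y / real k) ^ k) \<le> x"
    using powmap_le_below_x0[OF assms(1) x xle] assms(1) by (simp add: powmap_eq y_def)
  then have "inverse x \<le> (1 - y / real k) ^ k"
    using q x by (metis inverse_inverse_eq inverse_positive_iff_positive le_imp_inverse_le zero_less_power)
  then have "(inverse x) powr (1 / real k) \<le> ((1 - y / real k) ^ k) powr (1 / real k)"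
    using x by (intro powr_mono2) auto
  also have "\<dots> = 1 - y / real k"
    using q assms by (simp add: powr_powr flip: powr_realpow)
  \<comment> \<open>The gap is \<open>y / k^2 > 0\<close>. This is the strict step, so the case
    \<open>x = x0 k\<close> is included.\<close>
  also have "\<dots> < 1 - (real k - 1) * y / (real k)\<^sup>2"
    using assms x by (simp add: y_def field_simps power2_eq_square)
  finally have "0 < (1 - (real k - 1) * y / (real k)\<^sup>2) - x powr (- (1 / real k))"
    using x by (simp add: powr_minus inverse_powr)
  then have "0 < b2 k t n - b1 k t n"
    unfolding b1_b2_diff[OF assms(1,2) t] x_def[symmetric] y_def[symmetric]
    using assms by (intro mult_pos_pos) auto
  then show ?thesis by simp
qed

lemma b2_less_b1:
  assumes "k \<ge> 2" "t > 0" "t \<le> n" "real n \<le> 1 / x0' k * (real k + 1) * real t"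
  shows "b2 k t n < b1 k t n"
proof -
  define x where "x = (real k + 1) * real t / real n"
  define y where "y = (x - 1) / 2"
  have n: "n > 0" using assms(2,3) by simp
  have pos: "x0' k > 1" using x0'_fixed_point[OF assms(1)] x0'_low_bounds by simp
  then have x: "x0' k \<le> x" using n assms(4) by (simp add: x_def field_simps)
  with pos have x0: "x > 0" by simp
  have "(real k + 1) * real t \<le> (real k + 1) * real n" using assms(3) by (intro mult_left_mono) auto
  then have "x \<le> real k + 1" using n by (simp add: x_def field_simps)
  then have y: "y / real k \<le> 1 / 2" using assms(1) by (simp add: y_def field_simps)
  \<comment> \<open>\<open>16 / 9\<close> is the reciprocal of the largest coefficient
    \<open>coeff 2\<close>; squaring reduces the claim to \<open>exp 1 \<le> 3\<close>.\<close>
  have "exp (1 / 2 :: real) < 16 / 9"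
  proof (rule power2_less_imp_less)
    have "(exp (1 / 2 :: real))\<^sup>2 = exp 1" by (simp flip: exp_of_nat_mult)
    also have "\<dots> \<le> 3" by (rule exp_le)
    also have "\<dots> < (16 / 9)\<^sup>2" by (simp add: power2_eq_square)
    finally show "(exp (1 / 2 :: real))\<^sup>2 < (16 / 9)\<^sup>2" .
  qed simp
  then have "9 / 16 < exp (- (1 / 2 :: real))" by (simp add: exp_minus field_simps)
  with coeff_le[OF assms(1)] have "coeff k < exp (- (1 / 2))" by linarith
  also have "\<dots> \<le> exp (- (y / real k))" using y by simp
  finally have "expmap (coeff k) x < exp (- (y / real k)) * exp y"
    by (simp add: expmap_def y_def)
  with expmap_ge_above_x0'[OF assms(1) x] have "x < exp (y - y / real k)"
    by (simp add: exp_add[symmetric])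
  then have "exp (y - y / real k) powr (- (1 / real k)) < x powr (- (1 / real k))"
    using x0 assms by (intro powr_less_mono2_neg) auto
  \<comment> \<open>The exponent is \<open>(y - y / k) * (- 1 / k)\<close>.\<close>
  moreover have "exp (y - y / real k) powr (- (1 / real k)) = exp (- ((real k - 1) * y / (real k)\<^sup>2))"
    using assms by (simp add: powr_def field_simps power2_eq_square)
  moreover have "1 + - ((real k - 1) * y / (real k)\<^sup>2) \<le> exp (- ((real k - 1) * y / (real k)\<^sup>2))"
    by (rule exp_ge_add_one_self)
  ultimately have "(1 - (real k - 1) * y / (real k)\<^sup>2) - x powr (- (1 / real k)) < 0"
    by simp
  then have "b2 k t n - b1 k t n < 0"
    unfolding b1_b2_diff[OF assms(1) n assms(2)] x_def[symmetric] y_def[symmetric]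
    using assms by (intro mult_pos_neg) auto
  then show ?thesis by simp
qed

text \<open>Supplies \<open>t \<le> n\<close>, which in (b) bounds \<open>x\<close> by
  \<open>k + 1\<close>.\<close>

lemma card_le_card_closed_nbhd:
  assumes "simple_graph V E" "S \<subseteq> V"
  shows "card S \<le> card (closed_nbhd V E S)"
proof (rule card_mono)
  have "closed_nbhd V E S \<subseteq> V" using assms by (auto simp: closed_nbhd_def nbrs_def)
  then show "finite (closed_nbhd V E S)"
    using assms by (auto simp: simple_graph_def intro: finite_subset)
qed (auto simp: closed_nbhd_def)

theorem theorem3p1:
  fixes V :: "'a set" and E :: "'a set set" and k t n :: nat
  assumes "simple_graph V E"
    and "k = max_degree V E" and "k \<ge> 2"
    and "t = card (max_vertices V E)"
    and "n = card (closed_nbhd V E (max_vertices V E))"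
    and "n < (k + 1) * t"
  shows
    "((\<exists>!x::real. x > 1 \<and> exp ((x - 1) / 2) = x) \<and> 3.512 \<le> x1 \<and> x1 < 3.513 \<and>
      2.438 \<le> x0_low \<and> x0_low < 2.439 \<and>
      (\<forall>j\<ge>2. \<exists>!x::real. x0_low \<le> x \<and> x < x1 \<and>
         (2 * real j / (2 * real j + 1 - x)) ^ j = x) \<and>
      (real n \<ge> 1 / x0 k * (real k + 1) * real t \<longrightarrow> b1 k t n < b2 k t n) \<and>
      (\<forall>i j. 2 \<le> i \<and> i < j \<longrightarrow> x0 i < x0 j) \<and>
      (\<forall>\<delta>>0. \<forall>\<^sub>F j in sequentially. x0 j > x1 - \<delta>))
   \<and>
     ((\<exists>!x::real. x > 1 \<and> 1 / 4 * exp ((x - 1) / 2) = x) \<and>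
      7.908 \<le> x_quarter \<and> x_quarter < 7.909 \<and>
      (\<exists>!x::real. x > 1 \<and> 9 / 16 * exp ((x - 1) / 2) = x) \<and>
      5.594 \<le> x0'_low \<and> x0'_low < 5.595 \<and>
      (\<forall>j\<ge>2. \<exists>!x::real. x0'_low \<le> x \<and> x < x_quarter \<and>
         ((real j + 4) / (2 * real j + 4))\<^sup>2 * exp ((x - 1) / 2) = x) \<and>
      (real n \<le> 1 / x0' k * (real k + 1) * real t \<longrightarrow> b2 k t n < b1 k t n) \<and>
      (\<forall>i j. 2 \<le> i \<and> i < j \<longrightarrow> x0' i < x0' j))"
proof -
  \<comment> \<open>For \<open>t = 0\<close> the hypothesis would read \<open>n < 0\<close> in the
    natural numbers.\<close>
  have t: "t > 0" using assms(6) by (cases t) auto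
  have "t \<le> n"
    unfolding assms(4,5) by (rule card_le_card_closed_nbhd[OF assms(1)]) (auto simp: max_vertices_def)
  with t have "n > 0" by simp
  show ?thesis
    using x1_existence x1_bounds x0_low_bounds x0_existence[unfolded powmap_def]
      b1_less_b2[OF \<open>k \<ge> 2\<close> \<open>n > 0\<close> assms(6)] x0_strict_mono x0_eventually_gt
      x_quarter_existence x_quarter_bounds x0'_low_existence x0'_low_bounds
      x0'_existence[unfolded expmap_def coeff_def]
      b2_less_b1[OF \<open>k \<ge> 2\<close> t \<open>t \<le> n\<close>] x0'_strict_mono
    by (intro conjI allI impI; (elim conjE)?) assumption+
qed

end
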